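(* Let $\mathcal{L}=\langle L,\mathcal{F},\mathcal{P}\rangle$ be a computation states structure (as defined in the context) and let $f\in\mathcal{F}$ be a unary function $f:L\to L$ such that $L$ is the union of generalized closed disks $L[\bar r]$ each of which is $f$-stable. Then $f$ has at least one deep equilibrium: for every $f$-stable generalized closed disk $L[\bar r]$ there exists a map $f^*:L[\bar r]\to L[\bar r]$ which is idempotent, i.e. $f^*(f^*(v))=f^*(v)$ for all $v\in L[\bar r]$, and which is the pointwise limit (with respect to the type topology on $L[\bar r]$) of some net $(f^{m_i})_{i\in I}$ of iterates of $f$, i.e. $f^*(v)=\lim_i f^{m_i}(v)$ for every $v\in L[\bar r]$.
   Context: A computation states structure (CSS) is a triple $\mathcal{L}=\langle L,\mathcal{F},\mathcal{P}\rangle$ where $L$ is a set (of "layer states"), $\mathcal{F}$ is a collection of functions $L^n\to L$ (of various arities $n\ge 0$) closed under composition, and $\mathcal{P}$ is a collection of real-valued functions $P:L\to\mathbb{R}$ ("predicates"). The type topology on $L$ is the topology induced by the family of pseudometrics $d_P(v,w)=|P(v)-P(w)|$, $P\in\mathcal{P}$ (equivalently, the coarsest topology making every $P\in\mathcal{P}$ continuous); states with identical predicate values $P(v)=P(w)$ for all $P\in\mathcal{P}$ are identified. Standing hypotheses: every $f\in\mathcal{F}$ is continuous in the type topology (Continuity Hypothesis), and $L$ is complete with respect to the family of pseudometrics $(d_P)_{P\in\mathcal{P}}$ (Completeness Hypothesis). For $\bar r=(r_P)_{P\in\mathcal{P}}$ with $r_P\ge 0$, the generalized closed disk is $L[\bar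 r]=\{v\in L: |P(v)|\le r_P \text{ for all } P\in\mathcal{P}\}$. For unary $f:L\to L$, a disk $L[\bar r]$ is $f$-stable if $f(L[\bar r])\subseteq L[\bar r]$. Iterates: $f^m=f\circ\cdots\circ f$ ($m$ times), $m\ge 1$. *)

theory Defs
  imports "HOL-Analysis.Analysis"
begin

text \<open>A set of functions on a carrier is represented by extensional functions
  (\<open>\<rightarrow>\<^sub>E\<close>), so that HOL equality of functions is equality on the carrier.
  The power \<open>L\<^sup>n\<close> is \<open>{..<n} \<rightarrow>\<^sub>E L\<close>, the carrier of the library's product topology.\<close>

definition predicate_pdist :: "('a \<Rightarrow> real) \<Rightarrow> 'a \<Rightarrow> 'a \<Rightarrow> real" where
  "predicate_pdist P v w = \<bar>P v - P w\<bar>"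

text \<open>The set \<open>L\<close> itself is inserted into the subbase so that the carrier is \<open>L\<close> even if
  there are no predicates.\<close>

definition type_topology :: "'a set \<Rightarrow> ('a \<Rightarrow> real) set \<Rightarrow> 'a topology" where
  "type_topology L \<P> = topology_generated_by
     (insert L {{v \<in> L. predicate_pdist P w v < e} | P w e. P \<in> \<P> \<and> w \<in> L \<and> e > 0})"

text \<open>Completeness of the uniformity generated by the pseudometrics: every proper filter on \<open>L\<close>
  having, for each predicate, members of arbitrarily small diameter converges.
  (Cauchy sequences do not suffice for uncountable families of predicates; Cauchy filters and
  Cauchy nets give the same notion.)\<close>

definition cauchy_filter_on :: "'a set \<Rightarrow> ('a \<Rightarrow> real) set \<Rightarrow> 'a filter \<Rightarrow> bool" where
  "cauchy_filter_on L \<P> G \<longleftrightarrow>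
     G \<noteq> bot \<and> eventually (\<lambda>v. v \<in> L) G \<and>
     (\<forall>P\<in>\<P>. \<forall>e>0. \<exists>A\<subseteq>L. eventually (\<lambda>v. v \<in> A) G \<and>
        (\<forall>v\<in>A. \<forall>w\<in>A. predicate_pdist P v w < e))"

definition complete_states :: "'a set \<Rightarrow> ('a \<Rightarrow> real) set \<Rightarrow> bool" where
  "complete_states L \<P> \<longleftrightarrow>
     (\<forall>G. cauchy_filter_on L \<P> G \<longrightarrow> (\<exists>l. limitin (type_topology L \<P>) (\<lambda>v. v) l G))"

text \<open>\<open>\<F> n\<close> is the set of \<open>n\<close>-ary members of the collection of functions.
  Composition is superposition \<open>g (h\<^sub>0 x, \<dots>, h\<^bsub>n-1\<^esub> x)\<close> with inner functions of a common arity \<open>k\<close>;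
  for \<open>n = 0\<close> there is nothing to substitute.  Projections are not required to belong to \<open>\<F>\<close>.\<close>

locale computation_states_structure =
  fixes L :: "'a set"
    and \<F> :: "nat \<Rightarrow> ((nat \<Rightarrow> 'a) \<Rightarrow> 'a) set"
    and \<P> :: "('a \<Rightarrow> real) set"
  assumes operations: "\<F> n \<subseteq> ({..<n} \<rightarrow>\<^sub>E L) \<rightarrow>\<^sub>E L"
    and closed_composition:
      "\<lbrakk>n \<ge> 1; g \<in> \<F> n; \<And>i. i < n \<Longrightarrow> h i \<in> \<F> k\<rbrakk>
         \<Longrightarrow> (\<lambda>x\<in>{..<k} \<rightarrow>\<^sub>E L. g (\<lambda>i\<in>{..<n}. h i x)) \<in> \<F> k"
    and predicates: "\<P> \<subseteq> L \<rightarrow>\<^sub>E UNIV"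
    and identified: "\<lbrakk>v \<in> L; w \<in> L; \<And>P. P \<in> \<P> \<Longrightarrow> P v = P w\<rbrakk> \<Longrightarrow> v = w"
    and continuity:
      "g \<in> \<F> n \<Longrightarrow>
         continuous_map (product_topology (\<lambda>_. type_topology L \<P>) {..<n}) (type_topology L \<P>) g"
    and completeness: "complete_states L \<P>"

text \<open>A map \<open>f\<close> on \<open>L\<close> viewed as a member of \<open>(L\<^sup>1 \<rightarrow> L)\<close>; only the values of \<open>f\<close> on \<open>L\<close> matter.\<close>

definition unary_op :: "'a set \<Rightarrow> ('a \<Rightarrow> 'a) \<Rightarrow> (nat \<Rightarrow> 'a) \<Rightarrow> 'a" where
  "unary_op L f = (\<lambda>x\<in>{..<1} \<rightarrow>\<^sub>E L. f (x 0))"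

definition closed_disk :: "'a set \<Rightarrow> ('a \<Rightarrow> real) set \<Rightarrow> (('a \<Rightarrow> real) \<Rightarrow> real) \<Rightarrow> 'a set" where
  "closed_disk L \<P> r = {v \<in> L. \<forall>P\<in>\<P>. \<bar>P v\<bar> \<le> r P}"

definition radii :: "('a \<Rightarrow> real) set \<Rightarrow> (('a \<Rightarrow> real) \<Rightarrow> real) set" where
  "radii \<P> = {r. \<forall>P\<in>\<P>. r P \<ge> 0}"

definition disk_stable :: "('a \<Rightarrow> 'a) \<Rightarrow> 'a set \<Rightarrow> bool" where
  "disk_stable f D \<longleftrightarrow> f ` D \<subseteq> D"

text \<open>Nets: \<open>(i, j) \<in> r\<close> means that \<open>j\<close> is at or beyond \<open>i\<close>.  Convergence of a net is expressed
  through the library's filter limits, along the filter of tails; see \<open>limitin_net_filter\<close>.\<close>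

definition directed_set :: "'i set \<Rightarrow> 'i rel \<Rightarrow> bool" where
  "directed_set I r \<longleftrightarrow>
     I \<noteq> {} \<and> preorder_on I r \<and> (\<forall>i\<in>I. \<forall>j\<in>I. \<exists>k\<in>I. (i, k) \<in> r \<and> (j, k) \<in> r)"

definition net_filter :: "'i set \<Rightarrow> 'i rel \<Rightarrow> 'i filter" where
  "net_filter I r = (INF i\<in>I. principal {j \<in> I. (i, j) \<in> r})"

lemma eventually_net_filter:
  assumes "directed_set I r"
  shows "eventually Q (net_filter I r) \<longleftrightarrow> (\<exists>i\<in>I. \<forall>j\<in>I. (i, j) \<in> r \<longrightarrow> Q j)"
proof -
  have tr: "trans r" and ne: "I \<noteq> {}"
    using assms by (auto simp: directed_set_def preorder_on_def)
  have "eventually Q (net_filter I r) \<longleftrightarrow>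
          (\<exists>i\<in>I. eventually Q (principal {j \<in> I. (i, j) \<in> r}))"
    unfolding net_filter_def
  proof (rule eventually_INF_base[OF ne])
    fix a b assume "a \<in> I" "b \<in> I"
    then obtain k where "k \<in> I" "(a, k) \<in> r" "(b, k) \<in> r"
      using assms by (auto simp: directed_set_def)
    then show "\<exists>x\<in>I. principal {j \<in> I. (x, j) \<in> r}
        \<le> inf (principal {j \<in> I. (a, j) \<in> r}) (principal {j \<in> I. (b, j) \<in> r})"
      using tr by (intro bexI[of _ k]) (auto dest: transD)
  qed
  then show ?thesis by (auto simp: eventually_principal)
qed

lemma limitin_net_filter:
  assumes "directed_set I r"
  shows "limitin X x l (net_filter I r) \<longleftrightarrow>
    l \<in> topspace X \<and>
    (\<forall>U. openin X U \<and> l \<in> U \<longrightarrow> (\<exists>i\<in>I. \<forall>j\<in>I. (i, j) \<in> r \<longrightarrow> x j \<in> U))"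
  by (simp add: limitin_def eventually_net_filter[OF assms])

text \<open>\<open>g\<close> is the pointwise limit on \<open>D\<close>, in the topology \<open>X\<close>, of a net of iterates \<open>f\<^sup>m\<close>, \<open>m \<ge> 1\<close>.
  HOL cannot quantify over the type of the index set.  The type \<open>nat set \<times> nat\<close> loses nothing:
  if \<open>m\<close> is any net of natural numbers and \<open>G\<close> the image under \<open>m\<close> of its filter of tails, then
  the pairs \<open>(A, k)\<close> with \<open>A \<in> G\<close> and \<open>k \<in> A\<close>, directed by reverse inclusion of \<open>A\<close>, together
  with \<open>snd\<close> form a net with the same limits.\<close>

definition net_limit_of_iterates ::
    "'a topology \<Rightarrow> 'a set \<Rightarrow> ('a \<Rightarrow> 'a) \<Rightarrow> ('a \<Rightarrow> 'a) \<Rightarrow> bool" where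
  "net_limit_of_iterates X D f g \<longleftrightarrow>
     (\<exists>(I :: (nat set \<times> nat) set) r m.
        directed_set I r \<and> (\<forall>i\<in>I. m i \<ge> (1::nat)) \<and>
        (\<forall>v\<in>D. limitin X (\<lambda>i. (f ^^ m i) v) (g v) (net_filter I r)))"

end

theory Submission
  imports Defs
begin

text \<open>By completeness, evaluation at the predicates embeds \<open>L\<close> as a closed subset of a power of
  the real line, so a generalized closed disk \<open>D\<close> is compact Hausdorff by Tychonoff's theorem.  The
  closure \<open>E\<close> of the iterates of \<open>f\<close> in \<open>D\<^sup>D\<close> is then compact, and it is closed under composition:
  \<open>p \<mapsto> p \<circ> q\<close> is always continuous for pointwise convergence, and \<open>q \<mapsto> f\<^sup>m \<circ> q\<close> is
  because \<open>f\<close> is.  The Ellis-Numakura lemma yields an idempotent in \<open>E\<close>.\<close>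

section \<open>Idempotents in compact semigroups with continuous right translations\<close>

text \<open>In a minimal nonempty closed subsemigroup \<open>A\<close>, both \<open>A p\<close> and \<open>{q \<in> A. q p = p}\<close> equal \<open>A\<close>
  for every \<open>p \<in> A\<close>.\<close>

lemma compact_semigroup_idempotent:
  fixes mul :: "'b \<Rightarrow> 'b \<Rightarrow> 'b"
  assumes compact: "compact_space X" and hausdorff: "Hausdorff_space X"
    and nonempty: "topspace X \<noteq> {}"
    and closed: "\<And>p q. \<lbrakk>p \<in> topspace X; q \<in> topspace X\<rbrakk> \<Longrightarrow> mul p q \<in> topspace X"
    and assoc: "\<And>p q r. \<lbrakk>p \<in> topspace X; q \<in> topspace X; r \<in> topspace X\<rbrakk>
                  \<Longrightarrow> mul (mul p q) r = mul p (mul q r)"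
    and continuous: "\<And>q. q \<in> topspace X \<Longrightarrow> continuous_map X X (\<lambda>p. mul p q)"
  obtains p where "p \<in> topspace X" "mul p p = p"
proof -
  define S where
    "S = {A. closedin X A \<and> A \<noteq> {} \<and> (\<forall>p\<in>A. \<forall>q\<in>A. mul p q \<in> A)}"
  have "topspace X \<in> S"
    using nonempty closed by (auto simp: S_def)
  \<comment> \<open>Zorn's lemma is applied to reverse inclusion, so a maximal element is a minimal
    closed subsemigroup.\<close>
  have "\<exists>A\<in>S. \<forall>B\<in>S. A \<supseteq> B \<longrightarrow> B = A"
  proof (rule predicate_Zorn)
    show "partial_order_on S (relation_of (\<supseteq>) S)"
      by (rule partial_order_on_relation_ofI) auto
  next
    fix C assume "C \<in> Chains (relation_of (\<supseteq>) S)"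
    then have C: "subset.chain S C"
      by (auto simp: Chains_def relation_of_def subset_chain_def)
    show "\<exists>U\<in>S. \<forall>A\<in>C. A \<supseteq> U"
    proof (cases "C = {}")
      case True
      then show ?thesis using \<open>topspace X \<in> S\<close> by auto
    next
      case False
      \<comment> \<open>Finite intersection property: a finite nonempty subfamily of a chain
        contains its own intersection, and the empty subfamily has intersection \<open>UNIV\<close>.
        Compactness then makes \<open>\<Inter>C\<close> nonempty.\<close>
      have "\<Inter>\<A> \<noteq> {}" if "finite \<A>" "\<A> \<subseteq> C" for \<A>
      proof (cases "\<A> = {}")
        case False
        have "subset.chain S \<A>"
          using C \<open>\<A> \<subseteq> C\<close> by (simp add: subset_chain_def subset_iff)
        then have "\<Inter>\<A> \<in> \<A>"
          using that False by (intro Inter_in_chain)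
        then have "\<Inter>\<A> \<in> S"
          using C \<open>\<A> \<subseteq> C\<close> by (auto simp: subset_chain_def)
        then show ?thesis by (simp add: S_def)
      qed simp
      moreover have "\<forall>A\<in>C. closedin X A"
        using C by (auto simp: S_def subset_chain_def)
      ultimately have "\<Inter>C \<noteq> {}"
        using compact[unfolded compact_space_fip, THEN spec, of C, THEN mp] by simp
      then have "\<Inter>C \<in> S"
        using False C by (auto simp: S_def subset_chain_def intro!: closedin_Inter)
      then show ?thesis by blast
    qed
  qed
  then obtain A where A: "A \<in> S" and minimal: "\<And>B. \<lbrakk>B \<in> S; B \<subseteq> A\<rbrakk> \<Longrightarrow> B = A"
    by auto
  then have sub: "A \<subseteq> topspace X" and mulA: "\<And>p q. \<lbrakk>p \<in> A; q \<in> A\<rbrakk> \<Longrightarrow> mul p q \<in> A"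
    and clA: "closedin X A"
    by (auto simp: S_def closedin_subset)
  obtain p where "p \<in> A" using A by (auto simp: S_def)
  then have p: "p \<in> topspace X" using sub by blast
  \<comment> \<open>The continuous image of the compact set \<open>A\<close> is compact, hence
    closed in a Hausdorff space. Products stay inside because (q p)(r p) = ((q p) r) p.\<close>
  have "(\<lambda>q. mul q p) ` A \<in> S"
  proof -
    have "closedin X ((\<lambda>q. mul q p) ` A)"
      using compactin_imp_closedin[OF hausdorff]
        image_compactin[OF closedin_compact_space[OF compact clA] continuous[OF p]] by blast
    moreover have "mul (mul q p) (mul r p) \<in> (\<lambda>q. mul q p) ` A" if "q \<in> A" "r \<in> A" for q r
    proof
      show "mul (mul q p) (mul r p) = mul (mul (mul q p) r) p"
        using that sub p closed by (simp add: assoc subset_iff)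
      show "mul (mul q p) r \<in> A"
        using that \<open>p \<in> A\<close> mulA by blast
    qed
    ultimately show ?thesis using \<open>p \<in> A\<close> by (auto simp: S_def)
  qed
  then have "(\<lambda>q. mul q p) ` A = A"
    using minimal mulA \<open>p \<in> A\<close> by blast
  \<comment> \<open>Since p lies in A = A p, some left unit \<open>e\<close> for p exists in
    \<open>A\<close>; it makes the next set nonempty.\<close>
  then obtain e where e: "e \<in> A" "mul e p = p"
    using \<open>p \<in> A\<close> by (metis imageE)
  have "{q \<in> A. mul q p = p} \<in> S"
  proof -
    have "closedin X {q \<in> topspace X. mul q p = p}"
      using closedin_continuous_maps_eq[OF hausdorff continuous[OF p], of "\<lambda>_. p"] p by simp
    then have "closedin X (A \<inter> {q \<in> topspace X. mul q p = p})"
      using clA by blast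
    moreover have "A \<inter> {q \<in> topspace X. mul q p = p} = {q \<in> A. mul q p = p}"
      using sub by blast
    moreover have "mul (mul q r) p = p" if "q \<in> A" "r \<in> A" "mul q p = p" "mul r p = p" for q r
      using that sub p by (simp add: assoc subset_iff)
    ultimately show ?thesis using e mulA by (auto simp: S_def)
  qed
  then have "{q \<in> A. mul q p = p} = A"
    by (rule minimal) blast
  then show thesis using that p \<open>p \<in> A\<close> by blast
qed

section \<open>The type topology\<close>

lemma topspace_type_topology [simp]: "topspace (type_topology L \<P>) = L"
  by (auto simp: type_topology_def)

text \<open>A ball around P x inside an open set of reals pulls back to a subbasic disk around
  x.\<close>

lemma continuous_map_predicate:
  assumes "P \<in> \<P>"
  shows "continuous_map (type_topology L \<P>) euclideanreal P"
proof -
  have "\<exists>V. openin (type_topology L \<P>) V \<and> x \<in> V \<and> V \<subseteq> {v \<in> L. P v \<in> U}"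
    if U: "open U" "x \<in> L" "P x \<in> U" for U x
  proof -
    obtain e where e: "e > 0" "\<And>y. dist y (P x) < e \<Longrightarrow> y \<in> U"
      using U by (auto simp: open_dist)
    have "openin (type_topology L \<P>) {v \<in> L. predicate_pdist P x v < e}"
      unfolding type_topology_def
      by (rule topology_generated_by_Basis) (use assms U e in blast)
    then show ?thesis
      using U e
      by (intro exI[of _ "{v \<in> L. predicate_pdist P x v < e}"])
        (auto simp: predicate_pdist_def dist_real_def abs_minus_commute)
  qed
  then show ?thesis
    by (subst continuous_map_def, subst openin_subopen) auto
qed

text \<open>Distinct states differ in some predicate value, and disjoint open sets of reals around
  the two values pull back along that predicate.\<close>

lemma Hausdorff_type_topology:
  assumes "\<And>v w. \<lbrakk>v \<in> L; w \<in> L; \<And>P. P \<in> \<P> \<Longrightarrow> P v = P w\<rbrakk> \<Longrightarrow> v = w"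
  shows "Hausdorff_space (type_topology L \<P>)"
  unfolding Hausdorff_space_def
proof (intro allI impI)
  fix v w
  assume "v \<in> topspace (type_topology L \<P>) \<and> w \<in> topspace (type_topology L \<P>) \<and> v \<noteq> w"
  then have vw: "v \<in> L" "w \<in> L" "v \<noteq> w" by auto
  then obtain P where P: "P \<in> \<P>" "P v \<noteq> P w"
    using assms by blast
  then obtain U V where "open U" "open V" "P v \<in> U" "P w \<in> V" "U \<inter> V = {}"
    using hausdorff by meson
  with vw show "\<exists>U V. openin (type_topology L \<P>) U \<and> openin (type_topology L \<P>) V \<and>
      v \<in> U \<and> w \<in> V \<and> disjnt U V"
    using openin_continuous_map_preimage[OF continuous_map_predicate[OF P(1), of L]]
    by (intro exI[of _ "{x \<in> L. P x \<in> U}"] exI[of _ "{x \<in> L. P x \<in> V}"])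
      (auto simp: disjnt_def)
qed

section \<open>Embedding of the states into a power of the real line, and compactness of
  disks\<close>

text \<open>The restriction to \<open>\<P>\<close> places the values in the extensional carrier of
  the product topology.\<close>

definition evaluation :: "('a \<Rightarrow> real) set \<Rightarrow> 'a \<Rightarrow> ('a \<Rightarrow> real) \<Rightarrow> real" where
  "evaluation \<P> v = (\<lambda>P\<in>\<P>. P v)"

lemma evaluation_apply [simp]: "P \<in> \<P> \<Longrightarrow> evaluation \<P> v P = P v"
  by (simp add: evaluation_def)

text \<open>The neighbourhoods of a closure point y, pulled back to L, generate a Cauchy filter;
  completeness gives it a limit l, and the evaluation of l must be y.\<close>

lemma closedin_evaluation_image:
  assumes "complete_states L \<P>"
  shows "closedin (product_topology (\<lambda>_. euclideanreal) \<P>) (evaluation \<P> ` L)"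
proof -
  let ?T = "product_topology (\<lambda>_. euclideanreal) \<P>"
  have "y \<in> evaluation \<P> ` L" if y: "y \<in> ?T closure_of (evaluation \<P> ` L)" for y
  proof -
    have yT: "y \<in> topspace ?T" using y by (simp add: in_closure_of)
    define G where "G = inf (filtercomap (evaluation \<P>) (nhdsin ?T y)) (principal L)"
    have ev: "eventually Q G \<longleftrightarrow>
        (\<exists>U. openin ?T U \<and> y \<in> U \<and> (\<forall>v\<in>L. evaluation \<P> v \<in> U \<longrightarrow> Q v))" for Q
    proof
      assume "eventually Q G"
      then obtain R where "eventually R (nhdsin ?T y)" "\<forall>v. R (evaluation \<P> v) \<longrightarrow> v \<in> L \<longrightarrow> Q v"
        unfolding G_def eventually_inf_principal eventually_filtercomap by blast
      then show "\<exists>U. openin ?T U \<and> y \<in> U \<and> (\<forall>v\<in>L. evaluation \<P> v \<in> U \<longrightarrow> Q v)"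
        using yT unfolding eventually_nhdsin by metis
    next
      assume "\<exists>U. openin ?T U \<and> y \<in> U \<and> (\<forall>v\<in>L. evaluation \<P> v \<in> U \<longrightarrow> Q v)"
      then obtain U where "openin ?T U" "y \<in> U" "\<forall>v\<in>L. evaluation \<P> v \<in> U \<longrightarrow> Q v"
        by metis
      then show "eventually Q G"
        unfolding G_def eventually_inf_principal eventually_filtercomap eventually_nhdsin
        by (intro exI[of _ "\<lambda>z. z \<in> U"]) auto
    qed
    \<comment> \<open>Properness is exactly the statement that every neighbourhood of y meets the
      image of L.\<close>
    have G: "G \<noteq> bot"
      using y unfolding trivial_limit_def ev by (auto simp: in_closure_of)
    have conv: "(P \<longlongrightarrow> y P) G" if P: "P \<in> \<P>" for P
    proof (rule topological_tendstoI)
      fix U assume "open U" "y P \<in> U"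
      then show "eventually (\<lambda>v. P v \<in> U) G"
        using openin_continuous_map_preimage[OF
            continuous_map_product_projection[OF P, of "\<lambda>_. euclideanreal"], of U] yT P
        unfolding ev
        by (intro exI[of _ "{z \<in> topspace ?T. z P \<in> U}"]) (auto simp: evaluation_def)
    qed
    have L: "eventually (\<lambda>v. v \<in> L) G"
      by (simp add: G_def eventually_inf_principal)
    have "cauchy_filter_on L \<P> G"
      unfolding cauchy_filter_on_def
    proof (intro conjI ballI allI impI G L)
      fix P and e :: real assume "P \<in> \<P>" "e > 0"
      then have "eventually (\<lambda>v. dist (P v) (y P) < e / 2) G"
        using conv by (intro tendstoD) auto
      \<comment> \<open>Two values within e/2 of y P differ by less than e.\<close>
      then show "\<exists>A\<subseteq>L. eventually (\<lambda>v. v \<in> A) G \<and> (\<forall>v\<in>A. \<forall>w\<in>A. predicate_pdist P v w < e)"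
        using L
        by (intro exI[of _ "{v \<in> L. dist (P v) (y P) < e / 2}"])
          (auto simp: predicate_pdist_def dist_real_def eventually_conj_iff abs_real_def split: if_splits)
    qed
    then obtain l where l: "limitin (type_topology L \<P>) (\<lambda>v. v) l G"
      using assms by (auto simp: complete_states_def)
    \<comment> \<open>Along the proper filter \<open>G\<close> the real values of P tend both to P
      l, by continuity, and to y P.\<close>
    have "P l = y P" if P: "P \<in> \<P>" for P
    proof (rule tendsto_unique[OF G _ conv[OF P]])
      show "(P \<longlongrightarrow> P l) G"
        using continuous_map_limit[OF continuous_map_predicate[OF P] l] by (simp add: o_def)
    qed
    then have "y = evaluation \<P> l"
      using yT by (auto simp: evaluation_def PiE_iff extensional_def)
    moreover have "l \<in> L"
      using limitin_topspace[OF l] by simp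
    ultimately show ?thesis by blast
  qed
  then show ?thesis
    by (auto simp: closure_of_subset_eq[symmetric] evaluation_def)
qed

text \<open>Under evaluation the disk corresponds to a box of intervals intersected with the image
  of L. The box is compact by Tychonoff and the image is closed; the inverse of evaluation carries
  compactness back to L.\<close>

lemma compactin_closed_disk:
  assumes sep: "\<And>v w. \<lbrakk>v \<in> L; w \<in> L; \<And>P. P \<in> \<P> \<Longrightarrow> P v = P w\<rbrakk> \<Longrightarrow> v = w"
    and complete: "complete_states L \<P>"
  shows "compactin (type_topology L \<P>) (closed_disk L \<P> r)"
proof -
  let ?T = "product_topology (\<lambda>_. euclideanreal) \<P>"
  let ?S = "subtopology ?T (evaluation \<P> ` L)"
  let ?g = "inv_into L (evaluation \<P>)"
  let ?B = "\<Pi>\<^sub>E P\<in>\<P>. {- r P..r P}"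
  have inj: "inj_on (evaluation \<P>) L"
    by (rule inj_onI) (metis sep evaluation_def restrict_apply')
  have top: "topspace ?S = evaluation \<P> ` L"
    by (auto simp: evaluation_def)
  \<comment> \<open>Checking the subbase suffices: a disk for P around w corresponds to an open
    interval condition on the coordinate P.\<close>
  have "continuous_map ?S (type_topology L \<P>) ?g"
    unfolding type_topology_def
  proof (rule continuous_on_generated_topo)
    fix U
    assume "U \<in> insert L {{v \<in> L. predicate_pdist P w v < e} |P w e. P \<in> \<P> \<and> w \<in> L \<and> e > 0}"
    then consider "U = L"
      | P w e where "P \<in> \<P>" "U = {v \<in> L. predicate_pdist P w v < e}"
      by blast
    then show "openin ?S (?g -` U \<inter> topspace ?S)"
    proof cases
      case 1
      then have "?g -` U \<inter> topspace ?S = topspace ?S"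
        unfolding top using inj by auto
      then show ?thesis by (metis openin_topspace)
    next
      case 2
      have "?g -` U \<inter> topspace ?S = {y \<in> topspace ?S. y P \<in> {P w - e<..<P w + e}}"
        unfolding top using inj 2
        by (auto simp: predicate_pdist_def abs_less_iff)
      moreover have "openin ?S \<dots>"
        by (rule openin_continuous_map_preimage[OF continuous_map_from_subtopology
              [OF continuous_map_product_projection[OF \<open>P \<in> \<P>\<close>]]]) simp
      ultimately show ?thesis by simp
    qed
  next
    show "?g ` topspace ?S \<subseteq> \<Union> (insert L {{v \<in> L. predicate_pdist P w v < e} |P w e. P \<in> \<P> \<and> w \<in> L \<and> e > 0})"
      unfolding top using inj by auto
  qed
  then have "compactin (type_topology L \<P>) (?g ` (?B \<inter> evaluation \<P> ` L))"
  proof (rule image_compactin[rotated])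
    show "compactin ?S (?B \<inter> evaluation \<P> ` L)"
      unfolding compactin_subtopology
      using compact_Int_closedin[OF _ closedin_evaluation_image[OF complete]]
      by (simp add: compactin_PiE)
  qed
  moreover have "?B \<inter> evaluation \<P> ` L = evaluation \<P> ` closed_disk L \<P> r"
  proof -
    have "evaluation \<P> v \<in> ?B \<longleftrightarrow> (\<forall>P\<in>\<P>. \<bar>P v\<bar> \<le> r P)" for v
      by (auto simp: evaluation_def PiE_iff abs_le_iff minus_le_iff)
    then show ?thesis by (auto simp: closed_disk_def)
  qed
  moreover have "?g ` evaluation \<P> ` closed_disk L \<P> r = closed_disk L \<P> r"
    using inj by (intro inv_into_image_cancel) (auto simp: closed_disk_def)
  ultimately show ?thesis by (simp only:)
qed

section \<open>Unary operations and nets of iterates\<close>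

text \<open>Compose with the continuous map sending v to the 1-tuple (v).\<close>

lemma continuous_map_unary_op:
  assumes "continuous_map (product_topology (\<lambda>_. X) {..<1}) X (unary_op (topspace X) f)"
  shows "continuous_map X X f"
proof -
  have "continuous_map X (product_topology (\<lambda>_. X) {..<1::nat}) (\<lambda>v. \<lambda>i\<in>{..<1}. v)"
    by (auto simp: continuous_map_componentwise)
  from continuous_map_compose[OF this assms] show ?thesis
    by (rule continuous_map_eq) (auto simp: unary_op_def PiE_iff)
qed

text \<open>The usual net converging to a closure point, except that a neighbourhood U is recorded
  only through the set \<open>N U\<close> of exponents whose iterates lie in U. This keeps the
  indices in \<open>nat set \<times> nat\<close>.\<close>

lemma net_limit_of_iteratesI:
  assumes closure: "g \<in> product_topology (\<lambda>_. X) D closure_of {restrict (f ^^ m) D | m. m \<ge> 1}"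
  shows "net_limit_of_iterates X D f g"
proof -
  let ?T = "product_topology (\<lambda>_. X) D"
  define N where "N U = {m. m \<ge> 1 \<and> restrict (f ^^ m) D \<in> U}" for U
  define I where "I = {(A, k). k \<in> A \<and> (\<exists>U. openin ?T U \<and> g \<in> U \<and> A = N U)}"
  define r where "r = {(i, j). i \<in> I \<and> j \<in> I \<and> fst j \<subseteq> fst i}"
  have gD: "g \<in> topspace ?T"
    using closure by (simp add: in_closure_of)
  have N: "\<exists>k. k \<in> N U" if U: "openin ?T U" "g \<in> U" for U
    using closure[THEN in_closure_of[THEN iffD1], THEN conjunct2, THEN spec, of U] U
    by (auto simp: N_def)
  have dir: "directed_set I r"
    unfolding directed_set_def
  proof (intro conjI ballI)
    obtain k where "k \<in> N (topspace ?T)"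
      using N[OF openin_topspace gD] by (rule exE)
    then have "(N (topspace ?T), k) \<in> I"
      unfolding I_def using gD openin_topspace by blast
    then show "I \<noteq> {}" by blast
    show "preorder_on I r"
      by (auto simp: preorder_on_def r_def refl_on_def trans_def)
    fix i j assume ij: "i \<in> I" "j \<in> I"
    then obtain U V where UV: "openin ?T U" "g \<in> U" "fst i = N U" "openin ?T V" "g \<in> V" "fst j = N V"
      by (auto simp: I_def)
    \<comment> \<open>\<open>N (U \<inter> V)\<close> is contained in both \<open>N U\<close> and
      \<open>N V\<close>, so it supplies the common later index.\<close>
    obtain k where "k \<in> N (U \<inter> V)"
      using N[OF openin_Int[OF UV(1,4)] IntI[OF UV(2,5)]] by (rule exE)
    with UV show "\<exists>k\<in>I. (i, k) \<in> r \<and> (j, k) \<in> r"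
      using ij by (intro bexI[of _ "(N (U \<inter> V), k)"]) (auto simp: I_def r_def N_def)
  qed
  have "limitin X (\<lambda>i. (f ^^ snd i) v) (g v) (net_filter I r)" if v: "v \<in> D" for v
    unfolding limitin_net_filter[OF dir]
  proof (intro conjI allI impI)
    show "g v \<in> topspace X" using gD v by auto
    fix W assume W: "openin X W \<and> g v \<in> W"
    \<comment> \<open>The cylinder over W at the coordinate v turns product convergence into
      convergence at v. Any index j beyond (\<open>N U\<close>, k) has its exponent in
      \<open>N U\<close>.\<close>
    define U where "U = {h \<in> topspace ?T. h v \<in> W}"
    have U: "openin ?T U" "g \<in> U"
      unfolding U_def
      using W gD openin_continuous_map_preimage[OF continuous_map_product_projection[OF v]] by auto
    obtain k where k: "k \<in> N U" using N[OF U] by (rule exE)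
    then have "(N U, k) \<in> I" using U by (auto simp: I_def)
    moreover have "(f ^^ snd j) v \<in> W" if "((N U, k), j) \<in> r" for j
    proof -
      have "snd j \<in> N U" using that by (auto simp: r_def I_def)
      then show ?thesis using v by (auto simp: N_def U_def)
    qed
    ultimately show "\<exists>i\<in>I. \<forall>j\<in>I. (i, j) \<in> r \<longrightarrow> (f ^^ snd j) v \<in> W" by blast
  qed
  moreover have "\<forall>i\<in>I. snd i \<ge> 1" by (auto simp: I_def N_def)
  ultimately show ?thesis
    unfolding net_limit_of_iterates_def using dir
    by (intro exI[of _ I] exI[of _ r] exI[of _ snd] conjI ballI) simp_all
qed

section \<open>The semigroup of limits of iterates\<close>

lemma idempotent_limit_of_iterates:
  assumes compact: "compact_space X" and hausdorff: "Hausdorff_space X"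
    and f: "continuous_map X X f"
  obtains g where "g \<in> topspace X \<rightarrow> topspace X" "\<And>v. v \<in> topspace X \<Longrightarrow> g (g v) = g v"
    "net_limit_of_iterates X (topspace X) f g"
proof -
  let ?D = "topspace X"
  let ?T = "product_topology (\<lambda>_. X) ?D"
  \<comment> \<open>Exponents start at 1, since \<open>f ^^ 0\<close> would contribute the identity
    as a trivial idempotent.\<close>
  let ?F = "{restrict (f ^^ m) ?D | m. m \<ge> 1}"
  let ?E = "?T closure_of ?F"
  let ?Y = "subtopology ?T ?E"
  have ET: "?E \<subseteq> ?D \<rightarrow>\<^sub>E ?D"
    using closure_of_subset_topspace[of ?T ?F] by simp
  have topY: "topspace ?Y = ?E"
    using ET by auto
  have fm: "continuous_map X X (f ^^ m)" for m
  proof (induction m)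
    case (Suc m)
    from continuous_map_compose[OF this f] show ?case by (simp only: funpow.simps)
  qed (simp add: id_def)
  have fmD: "(f ^^ m) v \<in> ?D" if "v \<in> ?D" for m v
    using fm that by (auto simp: continuous_map_def)
  have FE: "?F \<subseteq> ?E"
    by (intro closure_of_subset) (auto simp: fmD)
  \<comment> \<open>The coordinate at v of p \<mapsto> p \<circ> q is the projection to the
    coordinate q v.\<close>
  have right: "continuous_map ?T ?T (\<lambda>p. compose ?D p q)" if "q \<in> ?E" for q
    using that ET unfolding continuous_map_componentwise
    by (auto simp: compose_def intro!: continuous_map_product_projection)
  \<comment> \<open>Stated for iterates only: a limit of iterates may be discontinuous, and then
    left composition with it need not be continuous.\<close>
  have left: "continuous_map ?T ?T (\<lambda>q. compose ?D (restrict (f ^^ m) ?D) q)" for m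
    unfolding continuous_map_componentwise
  proof (intro conjI ballI)
    fix v assume v: "v \<in> ?D"
    have "continuous_map ?T X ((f ^^ m) \<circ> (\<lambda>q. q v))"
      by (rule continuous_map_compose[OF continuous_map_product_projection[OF v] fm])
    then show "continuous_map ?T X (\<lambda>q. compose ?D (restrict (f ^^ m) ?D) q v)"
      by (rule continuous_map_eq) (use v in \<open>auto simp: compose_def\<close>)
  qed (auto simp: compose_def)
  have clE: "closedin ?T {x \<in> topspace ?T. h x \<in> ?E}" if "continuous_map ?T ?T h" for h
    using closedin_continuous_map_preimage[OF that closedin_closure_of] .
  \<comment> \<open>Closure under composition takes two passages to the limit. Here the left factor
    is an iterate: the preimage of \<open>?E\<close> under \<open>left\<close> is closed and
    contains \<open>?F\<close>, hence all of \<open>?E\<close>.\<close>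
  have mulF: "compose ?D (restrict (f ^^ m) ?D) q \<in> ?E" if "m \<ge> 1" "q \<in> ?E" for m q
    using that(2)
  proof (rule forall_in_closure_of[OF _ _ clE[OF left]])
    fix q assume "q \<in> ?F"
    then obtain n where n: "n \<ge> 1" "q = restrict (f ^^ n) ?D" by blast
    then have "compose ?D (restrict (f ^^ m) ?D) q = restrict (f ^^ (m + n)) ?D"
      by (auto simp: compose_def fmD funpow_add)
    then show "compose ?D (restrict (f ^^ m) ?D) q \<in> ?E"
      using FE n \<open>m \<ge> 1\<close> trans_le_add1 by blast
  qed
  \<comment> \<open>The second passage fixes q and lets the left factor range over the closure,
    using \<open>right\<close>.\<close>
  have mulE: "compose ?D p q \<in> ?E" if "p \<in> ?E" "q \<in> ?E" for p q
    using that(1)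
    by (rule forall_in_closure_of[OF _ _ clE[OF right[OF that(2)]]]) (use mulF that in blast)
  obtain g where g: "g \<in> topspace ?Y" "compose ?D g g = g"
  proof (rule compact_semigroup_idempotent[of ?Y "compose ?D"])
    show "compact_space ?Y"
      by (intro compact_space_subtopology closedin_compact_space)
        (simp_all add: compact compact_space_product_topology)
    show "Hausdorff_space ?Y"
      by (intro Hausdorff_space_subtopology) (simp add: hausdorff Hausdorff_space_product_topology)
    show "topspace ?Y \<noteq> {}"
      unfolding topY using FE by auto
    show "compose ?D p q \<in> topspace ?Y" if "p \<in> topspace ?Y" "q \<in> topspace ?Y" for p q
      using that mulE unfolding topY by simp
    show "continuous_map ?Y ?Y (\<lambda>p. compose ?D p q)" if "q \<in> topspace ?Y" for q
      using that continuous_map_from_subtopology[OF right] mulE unfolding topY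
      by (intro continuous_map_into_subtopology) (auto simp only: topY)
    show "compose ?D (compose ?D p q) s = compose ?D p (compose ?D q s)"
      if "p \<in> topspace ?Y" "q \<in> topspace ?Y" "s \<in> topspace ?Y" for p q s
      using compose_assoc[of s ?D ?D p q] ET that(3) unfolding topY by (auto simp: PiE_iff)
  qed (rule that)
  show thesis
  proof
    show "g \<in> ?D \<rightarrow> ?D" using g ET unfolding topY by auto
    show "g (g v) = g v" if "v \<in> ?D" for v
      using fun_cong[OF g(2), of v] that by (simp add: compose_def)
    show "net_limit_of_iterates X ?D f g"
      using g unfolding topY by (intro net_limit_of_iteratesI)
  qed
qed

theorem theorem2p5:
  fixes L :: "'a set"
    and \<F> :: "nat \<Rightarrow> ((nat \<Rightarrow> 'a) \<Rightarrow> 'a) set"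
    and \<P> :: "('a \<Rightarrow> real) set"
    and f :: "'a \<Rightarrow> 'a"
  assumes "computation_states_structure L \<F> \<P>"
    and "unary_op L f \<in> \<F> 1"
    and "\<exists>R \<subseteq> radii \<P>. (\<forall>r\<in>R. disk_stable f (closed_disk L \<P> r)) \<and> L = (\<Union>r\<in>R. closed_disk L \<P> r)"
  shows "\<forall>r\<in>radii \<P>. disk_stable f (closed_disk L \<P> r) \<longrightarrow>
    (\<exists>fstar. fstar \<in> closed_disk L \<P> r \<rightarrow> closed_disk L \<P> r \<and>
       (\<forall>v\<in>closed_disk L \<P> r. fstar (fstar v) = fstar v) \<and>
       net_limit_of_iterates (subtopology (type_topology L \<P>) (closed_disk L \<P> r))
         (closed_disk L \<P> r) f fstar)"
proof (intro ballI impI)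
  fix r assume stable: "disk_stable f (closed_disk L \<P> r)"
  interpret computation_states_structure L \<F> \<P> by fact
  let ?D = "closed_disk L \<P> r"
  let ?X = "subtopology (type_topology L \<P>) ?D"
  have top: "topspace ?X = ?D"
    by (auto simp: closed_disk_def)
  have "compact_space ?X"
    by (intro compact_space_subtopology compactin_closed_disk identified completeness)
  moreover have "Hausdorff_space ?X"
    by (intro Hausdorff_space_subtopology Hausdorff_type_topology identified)
  moreover have "continuous_map (type_topology L \<P>) (type_topology L \<P>) f"
    using continuity[OF assms(2)] by (intro continuous_map_unary_op) simp
  \<comment> \<open>Stability makes \<open>f\<close> a self-map of the compact Hausdorff space
    \<open>?X\<close>.\<close>
  then have "continuous_map ?X ?X f"
    using stable top
    by (intro continuous_map_into_subtopology continuous_map_from_subtopology)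
      (auto simp: disk_stable_def)
  ultimately obtain g where "g \<in> topspace ?X \<rightarrow> topspace ?X"
    "\<And>v. v \<in> topspace ?X \<Longrightarrow> g (g v) = g v"
    "net_limit_of_iterates ?X (topspace ?X) f g"
    using idempotent_limit_of_iterates[of ?X f] by blast
  then show "\<exists>fstar. fstar \<in> ?D \<rightarrow> ?D \<and> (\<forall>v\<in>?D. fstar (fstar v) = fstar v) \<and>
      net_limit_of_iterates ?X ?D f fstar"
    unfolding top by blast
qed

end
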